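(* Let $V$ be a Euclidean Jordan algebra with unit element $e$ and symmetric cone $K$, and suppose $a\in V$. Let $L_a$ be the linear transformation $L_a(x)=a\circ x$ on $V$. Then the following statements are equivalent: (i) $L_a$ is completely mixed (that is, the game $(L_a,e)$ is completely mixed). (ii) $a>0$ or $a<0$. (iii) $v(L_a)\neq 0$.
   Context: A Euclidean Jordan algebra $(V,\circ,\langle\cdot,\cdot\rangle)$ is a finite dimensional real inner product space with a commutative bilinear product $\circ$ and unit element $e$ satisfying $x\circ(x^2\circ y)=x^2\circ(x\circ y)$ and $\langle x\circ y,z\rangle=\langle y,x\circ z\rangle$, where $x^2=x\circ x$. An idempotent is an element $c$ with $c^2=c$; it is primitive if it is nonzero and not a sum of two nonzero idempotents. A Jordan frame is a set $\{e_1,\dots,e_n\}$ of mutually orthogonal primitive idempotents with sum $e$ ($n$ is the rank of $V$). Every $x\in V$ can be written $x=x_1e_1+\cdots+x_ne_n$ with $\{e_1,\dots,e_n\}$ a Jordan frame and $x_i\in\mathbb{R}$; $\operatorname{tr}(x)=x_1+\cdots+x_n$. The inner product is assumed to be the trace inner product $\langle x,y\rangle=\operatorname{tr}(x\circ y)$. The symmetric cone is $K=\{x\circ x:x\in V\}$, with interior $K^\circ$; $x>0$ means $x\in K^\circ$ and $x<0$ means $-x\in K^\circ$. Linear game (with $e$ the unit element): let $\Delta(e)=\{x\in K:\langle x,e\rangle=1\}$. For a linear $L:V\to V$, a pair $(\overline{x},\overline{y})\in\Delta(e)\times\Delta(e)$ is an optimal strategy pair if $\langle L(x),\overline{y}\rangle\le\langle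 L(\overline{x}),\overline{y}\rangle\le\langle L(\overline{x}),y\rangle$ for all $x,y\in\Delta(e)$. Such pairs exist, and the value is $v(L)=v(L,e)=\langle L(\overline{x}),\overline{y}\rangle=\max_{x\in\Delta(e)}\min_{y\in\Delta(e)}\langle L(x),y\rangle$. The game $(L,e)$ is completely mixed if for every optimal strategy pair $(\overline{x},\overline{y})$ both $\overline{x},\overline{y}\in K^\circ$.
   Formalization: The case dim V = 1 with a = 0 is excluded, since there the only optimal strategy pair (e,e) is interior, so (i) holds while (ii) and (iii) fail; V = {0}, where the game is undefined, is also excluded. *)

theory Defs
  imports "HOL-Analysis.Analysis"
begin

text \<open>
  The underlying inner product space is a type of class \<open>euclidean_space\<close>, whose inner product is an
  arbitrary inner product on a finite-dimensional real vector space of positive dimension.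
\<close>

locale euclidean_jordan_algebra =
  fixes jprod :: "'a::euclidean_space \<Rightarrow> 'a \<Rightarrow> 'a"  (infixl "\<odot>" 70)
    and e :: 'a
  assumes bilinear: "bilinear (\<odot>)"
    and commute: "x \<odot> y = y \<odot> x"
    and unit: "e \<odot> x = x"
    and jordan_identity: "x \<odot> ((x \<odot> x) \<odot> y) = (x \<odot> x) \<odot> (x \<odot> y)"
    and inner_assoc: "inner (x \<odot> y) z = inner y (x \<odot> z)"

definition idempotent :: "('a \<Rightarrow> 'a \<Rightarrow> 'a) \<Rightarrow> 'a \<Rightarrow> bool" where
  "idempotent jprod c \<longleftrightarrow> jprod c c = c"

definition primitive_idempotent ::
    "('a::real_vector \<Rightarrow> 'a \<Rightarrow> 'a) \<Rightarrow> 'a \<Rightarrow> bool" where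
  "primitive_idempotent jprod c \<longleftrightarrow>
     idempotent jprod c \<and> c \<noteq> 0 \<and>
     \<not> (\<exists>p q. idempotent jprod p \<and> idempotent jprod q \<and> p \<noteq> 0 \<and> q \<noteq> 0 \<and> c = p + q)"

text \<open>Orthogonality of idempotents is understood with respect to the Jordan product.\<close>

definition jordan_frame ::
    "('a::real_vector \<Rightarrow> 'a \<Rightarrow> 'a) \<Rightarrow> 'a \<Rightarrow> 'a set \<Rightarrow> bool" where
  "jordan_frame jprod e F \<longleftrightarrow>
     finite F \<and> (\<forall>c\<in>F. primitive_idempotent jprod c) \<and>
     (\<forall>c\<in>F. \<forall>d\<in>F. c \<noteq> d \<longrightarrow> jprod c d = 0) \<and>
     (\<Sum>c\<in>F. c) = e"

text \<open>
  By the spectral theorem every element of a Euclidean Jordan algebra has a decomposition along some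
  Jordan frame, and the sum of its coefficients does not depend on the decomposition.
\<close>

definition jordan_trace ::
    "('a::real_vector \<Rightarrow> 'a \<Rightarrow> 'a) \<Rightarrow> 'a \<Rightarrow> 'a \<Rightarrow> real" where
  "jordan_trace jprod e x =
     (THE t. \<exists>F \<xi>. jordan_frame jprod e F \<and> x = (\<Sum>c\<in>F. \<xi> c *\<^sub>R c) \<and> t = (\<Sum>c\<in>F. \<xi> c))"

definition symmetric_cone :: "('a \<Rightarrow> 'a \<Rightarrow> 'a) \<Rightarrow> 'a set" where
  "symmetric_cone jprod = {jprod x x | x. True}"

definition strategies :: "'a::real_inner set \<Rightarrow> 'a \<Rightarrow> 'a set" where
  "strategies K e = {x \<in> K. inner x e = 1}"

definition optimal_pair ::
    "'a::real_inner set \<Rightarrow> 'a \<Rightarrow> ('a \<Rightarrow> 'a) \<Rightarrow> 'a \<Rightarrow> 'a \<Rightarrow> bool" where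
  "optimal_pair K e L xb yb \<longleftrightarrow>
     xb \<in> strategies K e \<and> yb \<in> strategies K e \<and>
     (\<forall>x\<in>strategies K e. inner (L x) yb \<le> inner (L xb) yb) \<and>
     (\<forall>y\<in>strategies K e. inner (L xb) yb \<le> inner (L xb) y)"

text \<open>
  Optimal pairs exist for linear \<open>L\<close> by the minimax theorem; that they all give the same value, so
  that the description below is proper, is lemma \<open>game_value_eq\<close>.
\<close>

definition game_value :: "'a::real_inner set \<Rightarrow> 'a \<Rightarrow> ('a \<Rightarrow> 'a) \<Rightarrow> real" where
  "game_value K e L = (THE v. \<exists>xb yb. optimal_pair K e L xb yb \<and> v = inner (L xb) yb)"

definition completely_mixed :: "'a::real_inner set \<Rightarrow> 'a \<Rightarrow> ('a \<Rightarrow> 'a) \<Rightarrow> bool" where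
  "completely_mixed K e L \<longleftrightarrow>
     (\<forall>xb yb. optimal_pair K e L xb yb \<longrightarrow> xb \<in> interior K \<and> yb \<in> interior K)"

text \<open>
  Pitfall: in the one-dimensional algebra (the only one of rank one) the unit is the only strategy and
  it lies in the interior of the cone, so every game is completely mixed, including the zero
  transformation, which has value 0. That single case has to be excluded when complete mixedness is
  characterized by a nonzero value.
\<close>

lemma optimal_pair_value_unique:
  assumes "optimal_pair K e L x y" and "optimal_pair K e L x' y'"
  shows "inner (L x) y = inner (L x') y'"
proof (rule antisym)
  show "inner (L x) y \<le> inner (L x') y'"
    using assms unfolding optimal_pair_def by (meson order_trans)
  show "inner (L x') y' \<le> inner (L x) y"
    using assms unfolding optimal_pair_def by (meson order_trans)
qed

lemma game_value_eq:
  assumes "optimal_pair K e L x y"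
  shows "game_value K e L = inner (L x) y"
  unfolding game_value_def
  using assms optimal_pair_value_unique by (intro the_equality) blast+

end

theory Submission imports Defs begin

text \<open>
  Everything rests on the spectral decomposition \<open>a = (\<Sum>c\<in>F. \<alpha> c *\<^sub>R c)\<close> along orthogonal
  idempotents with sum \<open>e\<close> (lemma \<open>spectral_theorem\<close>). Membership of an element in the symmetric
  cone \<open>K\<close>, or in its interior, is read off from the signs of its coefficients, and \<open>K\<close> is its own
  dual cone (lemmas \<open>cone_iff_eigenvalues\<close>, \<open>interior_iff_eigenvalues\<close>, \<open>cone_self_dual\<close>).
  Optimal strategies can then be written down from \<open>F\<close> and \<open>\<alpha>\<close>.

  If \<open>a\<close> is in the interior of \<open>K\<close>, the normalized inverse of \<open>a\<close> is optimal for both players,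
  because \<open>L\<^sub>a\<close> maps it to a positive multiple of \<open>e\<close>; so the value is positive. For an arbitrary
  optimal pair \<open>(x, y)\<close> with value \<open>v > 0\<close>, optimality of \<open>x\<close> puts \<open>a \<odot> x\<close> in the interior, which
  forces \<open>x\<close> into the interior (lemma \<open>right_factor_in_interior\<close>). Optimality of \<open>y\<close> says
  \<open>v *\<^sub>R e - a \<odot> y \<in> K\<close>; this element is orthogonal to the interior point \<open>x\<close>, hence zero, and
  \<open>a \<odot> y = v *\<^sub>R e\<close> forces \<open>y\<close> into the interior as well. The case of \<open>- a\<close> in the interior is the
  same game with the players exchanged, since \<open>L\<^sub>a\<close> is self-adjoint.

  If neither \<open>a\<close> nor \<open>- a\<close> is in the interior, there are orthogonal idempotents \<open>c\<close> and \<open>d\<close> on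
  which \<open>a\<close> acts by scalars \<open>\<alpha> \<ge> 0\<close> and \<open>\<beta> \<le> 0\<close>. Normalized, they form an optimal pair of value 0
  that is not in the interior, so the game is not completely mixed
  (lemma \<open>indefinite_game_zero_value\<close>).

  The spectral decomposition is obtained inside the subalgebra generated by \<open>a\<close>, which is associative
  by power associativity: eigenspaces of multiplication operators split it into ideals until the
  idempotents are reached. Self-duality of \<open>K\<close> comes from the cubic equation satisfied by \<open>L\<^sub>c\<close> for an
  idempotent \<open>c\<close>, which makes \<open>L\<^sub>c\<close> positive semidefinite.
\<close>

context euclidean_jordan_algebra
begin

section \<open>Calculation rules\<close>

lemma left_add: "(x + y) \<odot> z = x \<odot> z + y \<odot> z"
  using bilinear by (rule bilinear_ladd)
lemma right_add: "x \<odot> (y + z) = x \<odot> y + x \<odot> z"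
  using bilinear by (rule bilinear_radd)
lemma left_diff: "(x - y) \<odot> z = x \<odot> z - y \<odot> z"
  using bilinear by (rule bilinear_lsub)
lemma right_diff: "x \<odot> (y - z) = x \<odot> y - x \<odot> z"
  using bilinear by (rule bilinear_rsub)
lemma left_scale: "(r *\<^sub>R x) \<odot> y = r *\<^sub>R (x \<odot> y)"
  using bilinear by (rule bilinear_lmul)
lemma right_scale: "x \<odot> (r *\<^sub>R y) = r *\<^sub>R (x \<odot> y)"
  using bilinear by (rule bilinear_rmul)
lemma left_zero: "0 \<odot> x = 0"
  using bilinear by (rule bilinear_lzero)
lemma right_zero: "x \<odot> 0 = 0"
  using bilinear by (rule bilinear_rzero)
lemma left_minus: "(- x) \<odot> y = - (x \<odot> y)"
  using bilinear by (rule bilinear_lneg)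
lemma linear_mult: "linear (\<lambda>y. x \<odot> y)"
  using bilinear by (simp add: bilinear_def)
lemma left_sum: "sum f A \<odot> y = (\<Sum>i\<in>A. f i \<odot> y)"
  by (induction A rule: infinite_finite_induct) (simp_all add: left_zero left_add)
lemma right_sum: "x \<odot> sum f A = (\<Sum>i\<in>A. x \<odot> f i)"
  by (induction A rule: infinite_finite_induct) (simp_all add: right_zero right_add)
lemma unit_right: "x \<odot> e = x"
  using unit[of x] commute[of e x] by simp

lemmas product_simps = left_add right_add left_diff right_diff left_scale right_scale
  left_zero right_zero left_minus unit unit_right

lemma inner_move: "inner (x \<odot> y) z = inner x (z \<odot> y)"
  using inner_assoc[of y x z] commute by metis

lemma unit_nonzero: "e \<noteq> 0"
proof
  assume "e = 0"
  then have "\<And>x. x = (0::'a)"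
    using unit by (metis left_zero)
  moreover obtain b :: 'a where "b \<in> Basis"
    using nonempty_Basis by blast
  ultimately show False
    using nonzero_Basis by blast
qed

section \<open>Powers of an element commute as multiplication operators\<close>

text \<open>
  The Jordan identity is cubic in its first argument; this is its full polarization.
\<close>

lemma linearized_jordan_identity:
  "(x \<odot> y) \<odot> (z \<odot> w) + (y \<odot> z) \<odot> (x \<odot> w) + (z \<odot> x) \<odot> (y \<odot> w)
   = z \<odot> ((x \<odot> y) \<odot> w) + x \<odot> ((y \<odot> z) \<odot> w) + y \<odot> ((z \<odot> x) \<odot> w)"
proof -
  \<comment> \<open>Inclusion-exclusion over the three arguments extracts the trilinear part, which counts
    every term twice.\<close>
  define J where "J t = t \<odot> ((t \<odot> t) \<odot> w) - (t \<odot> t) \<odot> (t \<odot> w)" for t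
  define D where "D = (z \<odot> ((x \<odot> y) \<odot> w) + x \<odot> ((y \<odot> z) \<odot> w) + y \<odot> ((z \<odot> x) \<odot> w))
    - ((x \<odot> y) \<odot> (z \<odot> w) + (y \<odot> z) \<odot> (x \<odot> w) + (z \<odot> x) \<odot> (y \<odot> w))"
  have "J t = 0" for t
    by (simp add: J_def jordan_identity)
  then have "0 = J (x + y + z) - J (x + y) - J (y + z) - J (x + z) + J x + J y + J z"
    by simp
  also have "\<dots> = D + D"
    unfolding J_def D_def
    by (simp add: product_simps commute[of y x] commute[of z y] commute[of x z] algebra_simps)
  finally have "D + D = 0" by simp
  then have "2 *\<^sub>R D = 0"
    by (simp add: scaleR_2)
  then have "D = 0" by simp
  then show ?thesis
    by (simp add: D_def)
qed

text \<open>
  Once \<open>z\<close> and \<open>w\<close> are exchanged, the polarized identity can be solved for the term in which \<open>w\<close>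
  multiplies the triple product; all other terms multiply by shorter products. It yields both the
  recursion for the operators of powers and the cubic equation for idempotents.
\<close>

lemma mult_of_triple_product:
  "((x \<odot> y) \<odot> z) \<odot> w
   = (x \<odot> y) \<odot> (z \<odot> w) + (y \<odot> z) \<odot> (x \<odot> w) + (z \<odot> x) \<odot> (y \<odot> w)
     - x \<odot> (z \<odot> (y \<odot> w)) - y \<odot> (z \<odot> (x \<odot> w))"
proof -
  have "(x \<odot> y) \<odot> (w \<odot> z) + (y \<odot> w) \<odot> (x \<odot> z) + (w \<odot> x) \<odot> (y \<odot> z)
   = w \<odot> ((x \<odot> y) \<odot> z) + x \<odot> ((y \<odot> w) \<odot> z) + y \<odot> ((w \<odot> x) \<odot> z)"
    by (rule linearized_jordan_identity)
  moreover have "w \<odot> z = z \<odot> w" "w \<odot> x = x \<odot> w"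
    "w \<odot> ((x \<odot> y) \<odot> z) = ((x \<odot> y) \<odot> z) \<odot> w"
    "((y \<odot> w) \<odot> z) = z \<odot> (y \<odot> w)" "(x \<odot> w) \<odot> z = z \<odot> (x \<odot> w)"
    "(y \<odot> w) \<odot> (x \<odot> z) = (z \<odot> x) \<odot> (y \<odot> w)"
    "(x \<odot> w) \<odot> (y \<odot> z) = (y \<odot> z) \<odot> (x \<odot> w)"
    by (metis commute)+
  ultimately show ?thesis
    by (simp only:) (simp add: algebra_simps)
qed

primrec jpower :: "'a \<Rightarrow> nat \<Rightarrow> 'a" where
  "jpower a 0 = e"
| "jpower a (Suc n) = a \<odot> jpower a n"

text \<open>
  Multiplication by a power of \<open>a\<close> is a polynomial in the multiplications by \<open>a\<close> and by \<open>a \<odot> a\<close>,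
  through a two-step recursion. Commutants express this without mentioning polynomials: what commutes
  with these two operators commutes with the operators of all powers.
\<close>

lemma commutes_with_powers:
  assumes "linear T"
    and T1: "\<And>w. T (a \<odot> w) = a \<odot> T w"
    and T2: "\<And>w. T ((a \<odot> a) \<odot> w) = (a \<odot> a) \<odot> T w"
  shows "T (jpower a n \<odot> w) = jpower a n \<odot> T w"
proof -
  have "(\<forall>w. T (jpower a n \<odot> w) = jpower a n \<odot> T w) \<and>
        (\<forall>w. T (jpower a (Suc n) \<odot> w) = jpower a (Suc n) \<odot> T w)"
  proof (induction n)
    case 0
    show ?case by (simp add: unit unit_right T1)
  next
    case (Suc n)
    have "jpower a (Suc (Suc n)) \<odot> w
      = jpower a (Suc n) \<odot> (a \<odot> w) + jpower a (Suc n) \<odot> (a \<odot> w) + (a \<odot> a) \<odot> (jpower a n \<odot> w)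
        - a \<odot> (a \<odot> (jpower a n \<odot> w)) - jpower a n \<odot> (a \<odot> (a \<odot> w))" for w
      using mult_of_triple_product[of a "jpower a n" a w]
      by (simp add: commute[of "jpower a n" a] commute[of "a \<odot> jpower a n" a])
    then show ?case
      using Suc T1 T2 linear_add[OF \<open>linear T\<close>] linear_diff[OF \<open>linear T\<close>] by simp
  qed
  then show ?thesis by blast
qed

text \<open>
  The Jordan identity says that multiplications by \<open>a\<close> and by \<open>a \<odot> a\<close> commute, so both commute with
  multiplication by every power; a second use of the commutant argument then applies to the latter.
\<close>

lemma power_operators_commute:
  "jpower a m \<odot> (jpower a n \<odot> w) = jpower a n \<odot> (jpower a m \<odot> w)"
proof -
  have "jpower a n \<odot> (a \<odot> w) = a \<odot> (jpower a n \<odot> w)" for n w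
    by (rule commutes_with_powers[OF linear_mult, symmetric]) (simp_all add: jordan_identity)
  moreover have "jpower a n \<odot> ((a \<odot> a) \<odot> w) = (a \<odot> a) \<odot> (jpower a n \<odot> w)" for n w
    by (rule commutes_with_powers[OF linear_mult, symmetric]) (simp_all add: jordan_identity)
  ultimately show ?thesis
    by (intro commutes_with_powers[OF linear_mult])
qed

lemma power_mult_power: "jpower a m \<odot> jpower a n = jpower a (m + n)"
proof (induction m)
  case 0
  show ?case by (simp add: unit)
next
  case (Suc m)
  have "jpower a (Suc m) \<odot> jpower a n = jpower a n \<odot> (jpower a 1 \<odot> jpower a m)"
    by (simp add: commute unit_right)
  also have "\<dots> = jpower a 1 \<odot> (jpower a n \<odot> jpower a m)"
    by (rule power_operators_commute)
  also have "\<dots> = a \<odot> jpower a (m + n)"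
    using Suc by (simp add: commute unit_right)
  finally show ?case by simp
qed

section \<open>The spectral theorem\<close>

definition generated_subalgebra :: "'a \<Rightarrow> 'a set" where
  "generated_subalgebra a = span (range (jpower a))"

lemma generated_closed:
  assumes "x \<in> generated_subalgebra a" "y \<in> generated_subalgebra a"
  shows "x \<odot> y \<in> generated_subalgebra a"
  using assms(1) unfolding generated_subalgebra_def
proof (induction rule: span_induct)
  case base
  show ?case
    by (auto simp: subspace_def product_simps span_zero span_add span_scale)
next
  case (step x)
  then obtain m where x: "x = jpower a m" by auto
  from assms(2) show ?case
    unfolding generated_subalgebra_def x mem_Collect_eq
  proof (induction rule: span_induct)
    case base
    show ?case
      by (auto simp: subspace_def product_simps span_zero span_add span_scale)
  next
    case (step y)
    then show ?case
      by (auto simp: power_mult_power intro: span_base)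
  qed
qed

lemma generated_commute:
  assumes "x \<in> generated_subalgebra a" "y \<in> generated_subalgebra a"
  shows "x \<odot> (y \<odot> w) = y \<odot> (x \<odot> w)"
  using assms(1) unfolding generated_subalgebra_def
proof (induction rule: span_induct)
  case base
  show ?case
    by (auto simp: subspace_def product_simps)
next
  case (step x)
  then obtain m where x: "x = jpower a m" by auto
  from assms(2) show ?case
    unfolding generated_subalgebra_def x mem_Collect_eq
  proof (induction rule: span_induct)
    case base
    show ?case
      by (auto simp: subspace_def product_simps)
  next
    case (step y)
    then show ?case
      by (auto simp: power_operators_commute)
  qed
qed

definition orthogonal_idempotents :: "'a set \<Rightarrow> bool" where
  "orthogonal_idempotents F \<longleftrightarrow>
     finite F \<and> 0 \<notin> F \<and> (\<forall>c\<in>F. \<forall>d\<in>F. c \<odot> d = (if c = d then c else 0))"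

text \<open>
  Multiplication operators are self-adjoint, so a maximizer of the Rayleigh quotient on the unit sphere
  of \<open>A\<close> is an eigenvector.
\<close>

lemma eigenvector_in_subspace:
  assumes "subspace A" and "\<And>z. z \<in> A \<Longrightarrow> x \<odot> z \<in> A" and "u \<in> A" "u \<noteq> 0"
  obtains \<mu> z where "z \<in> A" "z \<noteq> 0" "x \<odot> z = \<mu> *\<^sub>R z"
proof -
  let ?S = "A \<inter> sphere 0 1"
  have "compact ?S"
    using closed_subspace[OF assms(1)] by (simp add: closed_Int_compact)
  moreover have "?S \<noteq> {}"
  proof -
    have "u /\<^sub>R norm u \<in> ?S"
      using assms by (simp add: subspace_scale)
    then show ?thesis by blast
  qed
  moreover have "continuous_on ?S (\<lambda>z. inner (x \<odot> z) z)"
    by (intro continuous_intros linear_continuous_on)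
       (simp add: linear_conv_bounded_linear[symmetric] linear_mult)
  ultimately obtain z where z: "z \<in> ?S"
    and max: "\<And>w. w \<in> ?S \<Longrightarrow> inner (x \<odot> w) w \<le> inner (x \<odot> z) z"
    using continuous_attains_sup[of ?S "\<lambda>z. inner (x \<odot> z) z"] by blast
  define \<mu> where "\<mu> = inner (x \<odot> z) z"
  \<comment> \<open>The residual \<open>r\<close> vanishes because moving from the maximizer \<open>z\<close> in the direction of \<open>- r\<close>
    would otherwise violate the bound \<open>le\<close> to first order.\<close>
  define r where "r = \<mu> *\<^sub>R z - x \<odot> z"
  have nz: "inner z z = 1" "z \<noteq> 0"
    using z by (auto simp: dot_square_norm)
  have "r \<in> A"
    using z assms(1,2) by (simp add: r_def subspace_diff subspace_scale)
  have le: "inner (x \<odot> w) w \<le> \<mu> * inner w w" if "w \<in> A" for w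
  proof (cases "w = 0")
    case False
    then have "w /\<^sub>R norm w \<in> ?S"
      using that assms(1) by (simp add: subspace_scale)
    from max[OF this] have "inner (x \<odot> w) w / (norm w)\<^sup>2 \<le> \<mu>"
      by (simp add: product_simps \<mu>_def power2_eq_square divide_inverse mult_ac)
    then show ?thesis
      using False by (simp add: divide_le_eq dot_square_norm)
  qed (simp add: right_zero)
  define B where "B = \<mu> * inner r r - inner (x \<odot> r) r"
  have "B \<ge> 0"
    using le[OF \<open>r \<in> A\<close>] by (simp add: B_def)
  have quad: "0 \<le> t\<^sup>2 * B - 2 * t * inner r r" for t
  proof -
    have "z - t *\<^sub>R r \<in> A"
      using z \<open>r \<in> A\<close> assms(1) by (simp add: subspace_diff subspace_scale)
    from le[OF this] have "0 \<le> \<mu> * inner (z - t *\<^sub>R r) (z - t *\<^sub>R r)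
        - inner (x \<odot> (z - t *\<^sub>R r)) (z - t *\<^sub>R r)" by simp
    also have "\<dots> = \<mu> * inner z z - inner (x \<odot> z) z + t\<^sup>2 * B
        - 2 * t * (\<mu> * inner z r - inner (x \<odot> z) r)"
      using inner_assoc[of x r z]
      by (simp add: B_def product_simps power2_eq_square
          inner_commute[of r z] inner_commute[of r "x \<odot> z"] algebra_simps)
    also have "\<mu> * inner z r - inner (x \<odot> z) r = inner r r"
      by (metis r_def inner_diff_left inner_scaleR_left)
    also have "\<mu> * inner z z - inner (x \<odot> z) z = 0"
      by (simp add: nz \<mu>_def)
    finally show ?thesis by simp
  qed
  have "inner r r = 0"
  proof (rule ccontr)
    assume "inner r r \<noteq> 0"
    then have pos: "inner r r > 0" by simp
    \<comment> \<open>The \<open>+ 1\<close> keeps the denominator positive when \<open>B = 0\<close>.\<close>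
    define t where "t = inner r r / (B + 1)"
    have "t > 0" using pos \<open>B \<ge> 0\<close> by (simp add: t_def)
    have "t * B < 2 * inner r r"
    proof -
      have "t * (B + 1) = inner r r"
        using \<open>B \<ge> 0\<close> by (simp add: t_def)
      then have "t * B = inner r r - t" by (simp add: algebra_simps)
      then show ?thesis using pos \<open>t > 0\<close> by linarith
    qed
    then have "t * (t * B) < t * (2 * inner r r)"
      using \<open>t > 0\<close> by (rule mult_strict_left_mono)
    then show False
      using quad[of t] by (simp add: power2_eq_square algebra_simps)
  qed
  then have "x \<odot> z = \<mu> *\<^sub>R z"
    by (simp add: r_def)
  then show ?thesis
    using that z nz by blast
qed

text \<open>
  Induction on the dimension. If \<open>A\<close> contains more than multiples of its unit, shifting an element by
  an eigenvalue gives \<open>y \<noteq> 0\<close> in \<open>A\<close> whose annihilator \<open>I\<close> is a nonzero proper ideal. Since the inner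
  product is associative, the orthogonal complement \<open>J\<close> of \<open>I\<close> in \<open>A\<close> is an ideal too, and the
  components of the unit in \<open>I\<close> and \<open>J\<close> are units of these two smaller algebras. The commutation
  premise on \<open>A\<close>, combined with commutativity of the product, is associativity.
\<close>

lemma associative_subalgebra_spanned_by_idempotents:
  assumes "subspace A" and "\<And>x y. x \<in> A \<Longrightarrow> y \<in> A \<Longrightarrow> x \<odot> y \<in> A"
    and "\<And>x y z. x \<in> A \<Longrightarrow> y \<in> A \<Longrightarrow> z \<in> A \<Longrightarrow> x \<odot> (y \<odot> z) = y \<odot> (x \<odot> z)"
    and "u \<in> A" and "\<And>x. x \<in> A \<Longrightarrow> u \<odot> x = x"
  shows "\<exists>F \<subseteq> A. orthogonal_idempotents F \<and> \<Sum>F = u \<and> A = span F"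
  using assms
proof (induction "dim A" arbitrary: A u rule: less_induct)
  case less
  note sub = \<open>subspace A\<close> and closed = less.prems(2) and comm = less.prems(3)
    and uA = \<open>u \<in> A\<close> and unit_u = less.prems(5)
  show ?case
  proof (cases "A \<subseteq> span {u}")
    case True
    then have A: "A = span {u}"
      using uA sub by (simp add: span_minimal subset_antisym)
    show ?thesis
    proof (cases "u = 0")
      case True
      then show ?thesis using A
        by (intro exI[of _ "{}"]) (simp add: orthogonal_idempotents_def)
    next
      case False
      then show ?thesis using A uA unit_u
        by (intro exI[of _ "{u}"]) (simp add: orthogonal_idempotents_def)
    qed
  next
    case False
    then obtain x where x: "x \<in> A" "x \<notin> span {u}" by blast
    then have "x \<noteq> 0" by (auto simp: span_zero)
    then have "u \<noteq> 0" using unit_u[OF x(1)] left_zero by metis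
    with sub closed[OF x(1)] uA obtain \<mu> z where z: "z \<in> A" "z \<noteq> 0" "x \<odot> z = \<mu> *\<^sub>R z"
      using eigenvector_in_subspace by metis
    define y where "y = x - \<mu> *\<^sub>R u"
    have yA: "y \<in> A"
      using x uA sub by (simp add: y_def subspace_diff subspace_scale)
    have "y \<noteq> 0"
      using x(2) by (metis y_def eq_iff_diff_eq_0 span_base span_scale singletonI)
    define I where "I = {w \<in> A. y \<odot> w = 0}"
    define J where "J = {w \<in> A. \<forall>i\<in>I. inner w i = 0}"
    have "z \<in> I"
      using z unit_u[OF z(1)] by (simp add: I_def y_def product_simps)
    have "u \<notin> I"
      using \<open>y \<noteq> 0\<close> unit_u[OF yA] commute[of u y] by (simp add: I_def)
    have subI: "subspace I"
      using sub by (auto simp: I_def subspace_def product_simps)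
    have subJ: "subspace J"
      using sub by (auto simp: J_def subspace_def inner_add_left)
    have idealI: "w \<odot> i \<in> I" if "w \<in> A" "i \<in> I" for w i
      using that closed comm[OF yA] by (auto simp: I_def right_zero)
    have idealJ: "w \<odot> j \<in> J" if "w \<in> A" "j \<in> J" for w j
      using that closed idealI inner_assoc unfolding J_def by auto
    have disj: "w = 0" if "w \<in> I" "w \<in> J" for w
      using that by (auto simp: J_def)
    have "\<exists>p q. w = p + q \<and> p \<in> I \<and> q \<in> J" if wA: "w \<in> A" for w
    proof -
      obtain p q where pq: "p \<in> span I" "\<And>i. i \<in> span I \<Longrightarrow> orthogonal q i" "w = p + q"
        using orthogonal_subspace_decomp_exists by metis
      have pI: "p \<in> I" using pq(1) subI by (metis span_eq_iff)
      then have "q \<in> A"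
        using pq(3) wA sub subspace_diff[OF sub wA, of p] by (auto simp: I_def)
      then have "q \<in> J"
        using pq(2) by (auto simp: J_def orthogonal_def span_base)
      then show ?thesis using pq pI by blast
    qed
    note decomp = this
    obtain p q where pq: "u = p + q" "p \<in> I" "q \<in> J"
      using decomp[OF uA] by blast
    have IA: "I \<subseteq> A" and JA: "J \<subseteq> A" by (auto simp: I_def J_def)
    have prod_zero: "i \<odot> j = 0" if "i \<in> I" "j \<in> J" for i j
      using disj[of "i \<odot> j"] idealI[of j i] idealJ[of i j] that IA JA commute[of i j] by auto
    have unit_p: "p \<odot> i = i" if "i \<in> I" for i
      using unit_u[of i] that IA pq prod_zero[of i q] commute[of i q] by (auto simp: left_add)
    have unit_q: "q \<odot> j = j" if "j \<in> J" for j
      using unit_u[of j] that JA pq prod_zero[of p j] by (auto simp: left_add)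
    have "z \<notin> J" using disj \<open>z \<in> I\<close> z by blast
    have dimI: "dim I < dim A"
      using subI sub IA uA \<open>u \<notin> I\<close> by (intro dim_psubset) (auto simp: span_eq_iff[THEN iffD2])
    have dimJ: "dim J < dim A"
      using subJ sub JA z \<open>z \<notin> J\<close> by (intro dim_psubset) (auto simp: span_eq_iff[THEN iffD2])
    have "\<exists>F \<subseteq> I. orthogonal_idempotents F \<and> \<Sum>F = p \<and> I = span F"
      using IA unit_p pq idealI comm by (intro less.hyps[OF dimI subI]) blast+
    then obtain F where F: "F \<subseteq> I" "orthogonal_idempotents F" "\<Sum>F = p" "I = span F" by blast
    have "\<exists>G \<subseteq> J. orthogonal_idempotents G \<and> \<Sum>G = q \<and> J = span G"
      using JA unit_q pq idealJ comm by (intro less.hyps[OF dimJ subJ]) blast+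
    then obtain G where G: "G \<subseteq> J" "orthogonal_idempotents G" "\<Sum>G = q" "J = span G" by blast
    have "F \<inter> G = {}"
      using F G disj by (fastforce simp: orthogonal_idempotents_def)
    then have "\<Sum>(F \<union> G) = u"
      using F G pq by (simp add: sum.union_disjoint orthogonal_idempotents_def)
    moreover have "orthogonal_idempotents (F \<union> G)"
    proof -
      have "c \<odot> d = 0 \<and> d \<odot> c = 0" if "c \<in> F" "d \<in> G" for c d
        using that F(1) G(1) prod_zero[of c d] commute[of c d] by auto
      then show ?thesis
        using F(2) G(2) \<open>F \<inter> G = {}\<close> unfolding orthogonal_idempotents_def by auto
    qed
    moreover have "A = span (F \<union> G)"
    proof
      show "A \<subseteq> span (F \<union> G)"
      proof
        fix w assume "w \<in> A"
        then obtain i j where "w = i + j" "i \<in> I" "j \<in> J" using decomp by blast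
        then show "w \<in> span (F \<union> G)"
          using F(4) G(4) span_mono[of F "F \<union> G"] span_mono[of G "F \<union> G"]
          by (auto intro!: span_add)
      qed
      show "span (F \<union> G) \<subseteq> A"
        using F(1) G(1) IA JA sub by (intro span_minimal) auto
    qed
    moreover have "F \<union> G \<subseteq> A"
      using F(1) G(1) IA JA by auto
    ultimately show ?thesis by blast
  qed
qed

text \<open>
  A coarser notion than a decomposition along a Jordan frame: a member of \<open>F\<close> may split into further
  idempotents, on all of which the coefficient is then the same.
\<close>

definition spectral_decomposition :: "'a \<Rightarrow> 'a set \<Rightarrow> ('a \<Rightarrow> real) \<Rightarrow> bool" where
  "spectral_decomposition x F \<xi> \<longleftrightarrow>
     orthogonal_idempotents F \<and> \<Sum>F = e \<and> x = (\<Sum>c\<in>F. \<xi> c *\<^sub>R c)"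

lemma spectral_theorem: "\<exists>F \<xi>. spectral_decomposition x F \<xi>"
proof -
  let ?A = "generated_subalgebra x"
  have eA: "e \<in> ?A"
    unfolding generated_subalgebra_def by (metis jpower.simps(1) rangeI span_base)
  have xA: "x \<in> ?A"
    unfolding generated_subalgebra_def
    by (metis jpower.simps unit_right rangeI span_base)
  have "subspace ?A"
    by (simp add: generated_subalgebra_def)
  then obtain F where F: "orthogonal_idempotents F" "\<Sum>F = e" "?A = span F"
    using associative_subalgebra_spanned_by_idempotents[of ?A e]
      generated_closed generated_commute eA unit by blast
  then have "x \<in> range (\<lambda>\<xi>. \<Sum>c\<in>F. \<xi> c *\<^sub>R c)"
    using xA span_finite[of F] by (simp add: orthogonal_idempotents_def)
  then show ?thesis
    using F unfolding spectral_decomposition_def by blast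
qed

lemma spectral_mult:
  assumes "spectral_decomposition x F \<xi>" "c \<in> F"
  shows "x \<odot> c = \<xi> c *\<^sub>R c"
proof -
  have "x \<odot> c = (\<Sum>d\<in>F. \<xi> d *\<^sub>R (d \<odot> c))"
    using assms by (simp add: spectral_decomposition_def left_sum left_scale)
  also have "\<dots> = (\<Sum>d\<in>F. if d = c then \<xi> c *\<^sub>R c else 0)"
    using assms by (intro sum.cong) (auto simp: spectral_decomposition_def orthogonal_idempotents_def)
  finally show ?thesis
    using assms by (simp add: spectral_decomposition_def orthogonal_idempotents_def)
qed

lemma functional_calculus_mult:
  assumes "orthogonal_idempotents F"
  shows "(\<Sum>c\<in>F. \<xi> c *\<^sub>R c) \<odot> (\<Sum>c\<in>F. \<eta> c *\<^sub>R c) = (\<Sum>c\<in>F. (\<xi> c * \<eta> c) *\<^sub>R c)"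
proof -
  have "(\<Sum>c\<in>F. \<xi> c *\<^sub>R c) \<odot> (\<Sum>d\<in>F. \<eta> d *\<^sub>R d)
      = (\<Sum>c\<in>F. \<Sum>d\<in>F. if d = c then (\<xi> c * \<eta> c) *\<^sub>R c else 0)"
    unfolding left_sum right_sum
    using assms by (intro sum.cong) (auto simp: orthogonal_idempotents_def product_simps)
  then show ?thesis
    using assms by (simp add: orthogonal_idempotents_def)
qed

lemma spectral_member:
  assumes "spectral_decomposition x F \<xi>" "c \<in> F"
  shows "c \<odot> c = c" "c \<noteq> 0"
  using assms by (auto simp: spectral_decomposition_def orthogonal_idempotents_def)

lemma idempotent_inner_unit: "c \<odot> c = c \<Longrightarrow> inner c e = inner c c"
  using inner_move[of c c e] by (simp add: unit)

lemma spectral_inner: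
  assumes "spectral_decomposition x F \<xi>" "c \<in> F"
  shows "inner x c = \<xi> c * inner c c"
proof -
  have "inner x c = inner (x \<odot> c) c"
    using spectral_member[OF assms] inner_move[of x c c] by simp
  then show ?thesis by (simp add: spectral_mult[OF assms])
qed

section \<open>The symmetric cone is self-dual\<close>

abbreviation "K \<equiv> symmetric_cone (\<odot>)"

text \<open>
  For an idempotent, \<open>L = L\<^sub>c\<close> satisfies \<open>2L\<^sup>3 - 3L\<^sup>2 + L = 0\<close>, so its spectrum lies in \<open>{0, 1/2, 1}\<close>.
  On that set the polynomial \<open>t\<^sup>2 + 4(t - t\<^sup>2)\<^sup>2\<close> agrees with \<open>t\<close>, which turns \<open>L\<close> into a sum of squares
  of self-adjoint operators.
\<close>

lemma idempotent_mult_psd: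
  assumes "c \<odot> c = c"
  shows "0 \<le> inner (c \<odot> z) z"
proof -
  let ?u = "c \<odot> z" and ?v = "c \<odot> (c \<odot> z)"
  have three: "3 *\<^sub>R w = w + w + w" for w :: 'a
    using scaleR_left_distrib[of 1 2 w] by (simp add: scaleR_2)
  have cubic: "c \<odot> z = 3 *\<^sub>R (c \<odot> (c \<odot> z)) - 2 *\<^sub>R (c \<odot> (c \<odot> (c \<odot> z)))" for z
    using mult_of_triple_product[of c c c z] assms
    by (simp add: scaleR_2 three algebra_simps)
  have vv: "c \<odot> ?v = (3/2) *\<^sub>R ?v - (1/2) *\<^sub>R ?u"
  proof -
    have "2 *\<^sub>R (c \<odot> ?v) = 3 *\<^sub>R ?v - ?u"
      using cubic[of z] by (simp add: algebra_simps)
    then have "(1/2) *\<^sub>R (2 *\<^sub>R (c \<odot> ?v)) = (1/2) *\<^sub>R (3 *\<^sub>R ?v - ?u)" by simp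
    then show ?thesis by (simp add: scaleR_right_diff_distrib)
  qed
  have uu: "inner ?u ?u = inner ?v z"
    using inner_assoc[of c z ?u] inner_commute by metis
  have uv: "inner ?u ?v = (3/2) * inner ?v z - (1/2) * inner ?u z"
    using inner_assoc[of c z ?v] by (simp add: vv inner_diff_right inner_commute)
  have "inner ?v ?v = inner ?u (c \<odot> ?v)"
    by (rule inner_assoc)
  then have vv': "inner ?v ?v = (3/2) * inner ?u ?v - (1/2) * inner ?u ?u"
    by (simp add: vv inner_diff_right)
  have "inner (c \<odot> z) z = inner ?u ?u + 4 * inner (?u - ?v) (?u - ?v)"
    using uu uv vv' unfolding inner_diff_left inner_diff_right inner_commute[of ?v ?u]
    by argo
  then show ?thesis
    by simp
qed

lemma cone_inner_idempotent:
  assumes "x \<in> K" "c \<odot> c = c"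
  shows "0 \<le> inner x c"
proof -
  obtain z where "x = z \<odot> z"
    using assms(1) by (auto simp: symmetric_cone_def)
  then have "inner x c = inner (c \<odot> z) z"
    using inner_move[of z z c] by (simp add: inner_commute)
  then show ?thesis using idempotent_mult_psd[OF assms(2)] by simp
qed

lemma cone_iff_eigenvalues:
  assumes "spectral_decomposition x F \<xi>"
  shows "x \<in> K \<longleftrightarrow> (\<forall>c\<in>F. 0 \<le> \<xi> c)"
proof
  assume "x \<in> K"
  show "\<forall>c\<in>F. 0 \<le> \<xi> c"
  proof
    fix c assume "c \<in> F"
    then have "0 \<le> \<xi> c * inner c c" "c \<noteq> 0"
      using cone_inner_idempotent[OF \<open>x \<in> K\<close>] spectral_member[OF assms] spectral_inner[OF assms]
      by metis+
    then show "0 \<le> \<xi> c"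
      by (simp add: zero_le_mult_iff)
         (metis inner_eq_zero_iff inner_ge_zero order_antisym)
  qed
next
  assume nonneg: "\<forall>c\<in>F. 0 \<le> \<xi> c"
  let ?r = "\<Sum>c\<in>F. sqrt (\<xi> c) *\<^sub>R c"
  have "?r \<odot> ?r = (\<Sum>c\<in>F. (sqrt (\<xi> c) * sqrt (\<xi> c)) *\<^sub>R c)"
    using assms by (intro functional_calculus_mult) (simp add: spectral_decomposition_def)
  also have "\<dots> = x"
    using assms nonneg by (simp add: spectral_decomposition_def)
  finally show "x \<in> K"
    by (force simp: symmetric_cone_def)
qed

lemma idempotent_in_cone: "c \<odot> c = c \<Longrightarrow> c \<in> K"
  unfolding symmetric_cone_def by (metis (mono_tags, lifting) mem_Collect_eq)

lemma unit_in_cone: "e \<in> K"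
  by (simp add: idempotent_in_cone unit)

lemma cone_scale:
  assumes "x \<in> K" "0 \<le> r"
  shows "r *\<^sub>R x \<in> K"
proof -
  obtain z where "x = z \<odot> z"
    using assms by (auto simp: symmetric_cone_def)
  then have "r *\<^sub>R x = (sqrt r *\<^sub>R z) \<odot> (sqrt r *\<^sub>R z)"
    using assms(2) by (simp add: product_simps)
  then show ?thesis by (force simp: symmetric_cone_def)
qed

text \<open>
  Both directions test against idempotents only: members of \<open>K\<close> are nonnegative combinations of
  idempotents, and the coefficients of \<open>x\<close> are its inner products with idempotents up to positive
  factors.
\<close>

lemma cone_self_dual: "x \<in> K \<longleftrightarrow> (\<forall>y\<in>K. 0 \<le> inner x y)"
proof
  assume x: "x \<in> K"
  show "\<forall>y\<in>K. 0 \<le> inner x y"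
  proof
    fix y assume y: "y \<in> K"
    obtain F \<eta> where F: "spectral_decomposition y F \<eta>"
      using spectral_theorem by blast
    then have "inner x y = (\<Sum>c\<in>F. \<eta> c * inner x c)"
      by (simp add: spectral_decomposition_def inner_sum_right)
    also have "\<dots> \<ge> 0"
      using cone_iff_eigenvalues[OF F] y x cone_inner_idempotent spectral_member[OF F]
      by (intro sum_nonneg) simp
    finally show "0 \<le> inner x y" .
  qed
next
  assume dual: "\<forall>y\<in>K. 0 \<le> inner x y"
  obtain F \<xi> where F: "spectral_decomposition x F \<xi>"
    using spectral_theorem by blast
  have "0 \<le> \<xi> c" if "c \<in> F" for c
  proof -
    have "0 \<le> \<xi> c * inner c c" "0 < inner c c"
      using dual that spectral_inner[OF F] spectral_member[OF F] idempotent_in_cone by force+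
    then show ?thesis by (simp add: zero_le_mult_iff)
  qed
  then show "x \<in> K" using cone_iff_eigenvalues[OF F] by blast
qed

text \<open>
  Boundedness of the product gives \<open>norm c \<le> B * (norm c)\<^sup>2\<close>. The bound makes estimates uniform over the
  idempotents of all spectral decompositions.
\<close>

lemma idempotents_bounded_below:
  obtains \<delta> where "\<delta> > 0" "\<And>c. c \<odot> c = c \<Longrightarrow> c \<noteq> 0 \<Longrightarrow> \<delta> \<le> norm c"
proof -
  obtain B where B: "B > 0" "\<And>x y. norm (x \<odot> y) \<le> B * norm x * norm y"
    using bilinear_bounded_pos[OF bilinear] by blast
  have "1 / B \<le> norm c" if "c \<odot> c = c" "c \<noteq> 0" for c
  proof -
    have "1 * norm c \<le> (B * norm c) * norm c"
      using B(2)[of c c] that by simp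
    then have "1 \<le> B * norm c"
      using that(2) by (subst (asm) mult_le_cancel_right) simp
    then show ?thesis using B(1) by (simp add: divide_le_eq mult.commute)
  qed
  then show ?thesis using that[of "1 / B"] B(1) by simp
qed

lemma interior_inner_pos:
  assumes "x \<in> interior K" "y \<in> K" "y \<noteq> 0"
  shows "0 < inner x y"
proof -
  obtain r where r: "r > 0" "cball x r \<subseteq> K"
    using assms(1) mem_interior_cball by blast
  define t where "t = r / norm y"
  have "t > 0" using r assms(3) by (simp add: t_def)
  have "x - t *\<^sub>R y \<in> cball x r"
    using r assms(3) by (simp add: dist_norm t_def)
  then have "0 \<le> inner (x - t *\<^sub>R y) y"
    using r assms(2) cone_self_dual by blast
  then have "t * inner y y \<le> inner x y"
    by (simp add: inner_diff_left)
  moreover have "0 < t * inner y y" using \<open>t > 0\<close> assms(3) by simp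
  ultimately show ?thesis by simp
qed

text \<open>
  For the converse direction let \<open>m\<close> be the least coefficient of \<open>x\<close>. Then \<open>x - m *\<^sub>R e \<in> K\<close> and so
  \<open>inner x d \<ge> m * (norm d)\<^sup>2\<close> for every idempotent \<open>d\<close>. A perturbation of \<open>x\<close> of norm at most
  \<open>m * \<delta>\<close>, with \<open>\<delta>\<close> a lower bound for the norms of nonzero idempotents, does not make this inner
  product negative, so all coefficients stay nonnegative.
\<close>

lemma interior_iff_eigenvalues:
  assumes F: "spectral_decomposition x F \<xi>"
  shows "x \<in> interior K \<longleftrightarrow> (\<forall>c\<in>F. 0 < \<xi> c)"
proof
  assume x: "x \<in> interior K"
  show "\<forall>c\<in>F. 0 < \<xi> c"
  proof
    fix c assume c: "c \<in> F"
    then have "0 < inner x c"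
      using interior_inner_pos[OF x] spectral_member[OF F] idempotent_in_cone by blast
    then have "0 < \<xi> c * inner c c"
      using spectral_inner[OF F c] by simp
    then show "0 < \<xi> c"
      by (metis inner_ge_zero zero_less_mult_pos2 mult_zero_right order_less_le)
  qed
next
  assume pos: "\<forall>c\<in>F. 0 < \<xi> c"
  have finF: "finite F" and sumF: "\<Sum>F = e" and x: "x = (\<Sum>c\<in>F. \<xi> c *\<^sub>R c)"
    and orth: "orthogonal_idempotents F"
    using F by (auto simp: spectral_decomposition_def orthogonal_idempotents_def)
  have "F \<noteq> {}" using sumF unit_nonzero by auto
  define m where "m = Min (\<xi> ` F)"
  have "m > 0" and m_le: "\<And>c. c \<in> F \<Longrightarrow> m \<le> \<xi> c"
    using finF \<open>F \<noteq> {}\<close> pos by (auto simp: m_def)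
  have "x - m *\<^sub>R e = (\<Sum>c\<in>F. (\<xi> c - m) *\<^sub>R c)"
    by (simp add: x sumF[symmetric] scaleR_left_diff_distrib sum_subtractf scaleR_sum_right)
  then have "spectral_decomposition (x - m *\<^sub>R e) F (\<lambda>c. \<xi> c - m)"
    using orth sumF by (simp add: spectral_decomposition_def)
  then have shifted: "x - m *\<^sub>R e \<in> K"
    using cone_iff_eigenvalues m_le by force
  obtain \<delta> where \<delta>: "\<delta> > 0" "\<And>c. c \<odot> c = c \<Longrightarrow> c \<noteq> 0 \<Longrightarrow> \<delta> \<le> norm c"
    using idempotents_bounded_below by blast
  have "cball x (m * \<delta>) \<subseteq> K"
  proof
    fix y assume "y \<in> cball x (m * \<delta>)"
    then have near: "norm (x - y) \<le> m * \<delta>" by (simp add: dist_norm)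
    obtain G \<eta> where G: "spectral_decomposition y G \<eta>"
      using spectral_theorem by blast
    have "0 \<le> \<eta> d" if d: "d \<in> G" for d
    proof -
      note idem = spectral_member[OF G d]
      have "0 \<le> inner (x - m *\<^sub>R e) d"
        by (rule cone_inner_idempotent[OF shifted idem(1)])
      then have "m * (norm d)\<^sup>2 \<le> inner x d"
        using idempotent_inner_unit[OF idem(1)]
        by (simp add: inner_diff_left inner_commute[of e] dot_square_norm)
      moreover have "inner (x - y) d \<le> m * norm d * norm d"
      proof -
        have "inner (x - y) d \<le> norm (x - y) * norm d"
          by (rule norm_cauchy_schwarz)
        also have "\<dots> \<le> m * norm d * norm d"
          using near \<delta>(2)[OF idem] \<open>m > 0\<close>
          by (intro mult_right_mono) (auto intro: order_trans)
        finally show ?thesis .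
      qed
      ultimately have "0 \<le> inner y d"
        by (simp add: inner_diff_left power2_eq_square mult_ac)
      then have "0 \<le> \<eta> d * inner d d"
        using spectral_inner[OF G d] by simp
      moreover have "0 < inner d d" using idem by simp
      ultimately show ?thesis by (simp add: zero_le_mult_iff)
    qed
    then show "y \<in> K" using cone_iff_eigenvalues[OF G] by blast
  qed
  then show "x \<in> interior K"
    using mem_interior_cball \<open>m > 0\<close> \<delta>(1) by (metis mult_pos_pos)
qed

lemma interior_iff_inner_pos:
  "x \<in> interior K \<longleftrightarrow> (\<forall>y\<in>K. y \<noteq> 0 \<longrightarrow> 0 < inner x y)"
proof
  assume "x \<in> interior K"
  then show "\<forall>y\<in>K. y \<noteq> 0 \<longrightarrow> 0 < inner x y"
    using interior_inner_pos by blast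
next
  assume dual: "\<forall>y\<in>K. y \<noteq> 0 \<longrightarrow> 0 < inner x y"
  obtain F \<xi> where F: "spectral_decomposition x F \<xi>"
    using spectral_theorem by blast
  have "0 < \<xi> c" if c: "c \<in> F" for c
  proof -
    have "0 < \<xi> c * inner c c" "0 < inner c c"
      using dual c spectral_inner[OF F] spectral_member[OF F] idempotent_in_cone by force+
    then show ?thesis by (simp add: zero_less_mult_iff)
  qed
  then show "x \<in> interior K" using interior_iff_eigenvalues[OF F] by blast
qed

lemma unit_in_interior: "e \<in> interior K"
proof -
  have "spectral_decomposition e {e} (\<lambda>_. 1)"
    using unit_nonzero by (simp add: spectral_decomposition_def orthogonal_idempotents_def unit)
  then show ?thesis by (simp add: interior_iff_eigenvalues)
qed

lemma interior_scale:
  assumes "x \<in> interior K" "0 < r"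
  shows "r *\<^sub>R x \<in> interior K"
  using assms by (simp add: interior_iff_inner_pos)

text \<open>
  If some coefficient \<open>\<xi> c\<close> of \<open>x\<close> vanished, then \<open>x \<odot> c = 0\<close> and
  \<open>inner (a \<odot> x) c = inner a (x \<odot> c) = 0\<close>, although an interior point has positive inner product with \<open>c\<close>.
\<close>

lemma right_factor_in_interior:
  assumes "x \<in> K" "a \<odot> x \<in> interior K"
  shows "x \<in> interior K"
proof -
  obtain F \<xi> where F: "spectral_decomposition x F \<xi>"
    using spectral_theorem by blast
  have "0 < \<xi> c" if c: "c \<in> F" for c
  proof -
    have "0 < inner (a \<odot> x) c"
      using interior_inner_pos[OF assms(2)] spectral_member[OF F c] idempotent_in_cone by blast
    also have "inner (a \<odot> x) c = \<xi> c * inner a c"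
      using inner_move[of a x c] spectral_mult[OF F c] commute[of c x] by simp
    finally have "\<xi> c \<noteq> 0" by auto
    moreover have "0 \<le> \<xi> c" using assms(1) cone_iff_eigenvalues[OF F] c by blast
    ultimately show ?thesis by simp
  qed
  then show ?thesis using interior_iff_eigenvalues[OF F] by blast
qed

section \<open>The game of a multiplication operator\<close>

lemma inner_unit_pos: "x \<in> K \<Longrightarrow> x \<noteq> 0 \<Longrightarrow> 0 < inner x e"
  using interior_inner_pos[OF unit_in_interior] by (metis inner_commute)

lemma strategy_nonzero: "x \<in> strategies K e \<Longrightarrow> x \<in> K \<and> x \<noteq> 0 \<and> inner x e = 1"
  by (auto simp: strategies_def)

lemma normalized_strategy:
  assumes "x \<in> K" "x \<noteq> 0"
  shows "x /\<^sub>R inner x e \<in> strategies K e"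
  using assms inner_unit_pos[OF assms] by (simp add: strategies_def cone_scale)

text \<open>
  For a self-adjoint payoff operator, negation amounts to exchanging the players.
\<close>

lemma optimal_pair_neg:
  "optimal_pair K e (\<lambda>x. - a \<odot> x) y x \<longleftrightarrow> optimal_pair K e (\<lambda>x. a \<odot> x) x y"
proof -
  have "inner (a \<odot> x) y = inner (a \<odot> y) x" for x y
    using inner_assoc[of a x y] by (simp add: inner_commute)
  then show ?thesis
    unfolding optimal_pair_def left_minus by auto
qed

text \<open>
  The common strategy is the inverse \<open>b\<close> of \<open>a\<close>, divided by \<open>s = inner b e\<close>: since \<open>a \<odot> b = e\<close>, the
  payoff is \<open>1 / s\<close> as soon as one of the players uses it.
\<close>

lemma positive_game_has_positive_value:
  assumes "a \<in> interior K"
  shows "\<exists>x y. optimal_pair K e (\<lambda>x. a \<odot> x) x y \<and> 0 < inner (a \<odot> x) y"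
proof -
  obtain F \<alpha> where F: "spectral_decomposition a F \<alpha>"
    using spectral_theorem by blast
  then have pos: "\<forall>c\<in>F. 0 < \<alpha> c" using interior_iff_eigenvalues assms by blast
  define b where "b = (\<Sum>c\<in>F. (1 / \<alpha> c) *\<^sub>R c)"
  have "a \<odot> b = (\<Sum>c\<in>F. (\<alpha> c * (1 / \<alpha> c)) *\<^sub>R c)"
    using F by (simp add: b_def spectral_decomposition_def functional_calculus_mult del: times_divide_eq_right)
  also have "\<dots> = (\<Sum>c\<in>F. c)"
    using pos by (intro sum.cong) auto
  finally have ab: "a \<odot> b = e" using F by (simp add: spectral_decomposition_def)
  have "spectral_decomposition b F (\<lambda>c. 1 / \<alpha> c)"
    using F by (simp add: spectral_decomposition_def b_def)
  then have "b \<in> K" using pos cone_iff_eigenvalues by force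
  have "b \<noteq> 0" using ab right_zero unit_nonzero by metis
  define s where "s = inner b e"
  define x where "x = b /\<^sub>R s"
  have "s > 0" using \<open>b \<in> K\<close> \<open>b \<noteq> 0\<close> by (simp add: s_def inner_unit_pos)
  have x: "x \<in> strategies K e"
    using normalized_strategy[OF \<open>b \<in> K\<close> \<open>b \<noteq> 0\<close>] by (simp add: x_def s_def)
  have ax: "a \<odot> x = e /\<^sub>R s" by (simp add: x_def right_scale ab)
  have 1: "inner (a \<odot> x) y = 1 / s" if "y \<in> strategies K e" for y
    using that by (simp add: ax strategies_def inner_commute[of e] divide_inverse)
  have 2: "inner (a \<odot> y) x = 1 / s" if "y \<in> strategies K e" for y
    using 1[OF that] inner_assoc[of a y x] by (simp add: inner_commute)
  have "optimal_pair K e (\<lambda>x. a \<odot> x) x x"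
    using x 1 2 by (simp add: optimal_pair_def)
  moreover have "0 < inner (a \<odot> x) x" using 1[OF x] \<open>s > 0\<close> by simp
  ultimately show ?thesis by blast
qed

lemma positive_game_completely_mixed:
  assumes a: "a \<in> interior K" and opt: "optimal_pair K e (\<lambda>x. a \<odot> x) x y"
  shows "x \<in> interior K \<and> y \<in> interior K"
proof -
  define v where "v = inner (a \<odot> x) y"
  have x: "x \<in> K" "inner x e = 1" and y: "y \<in> K" "y \<noteq> 0" "inner y e = 1"
    and maxi: "\<And>z. z \<in> strategies K e \<Longrightarrow> inner (a \<odot> z) y \<le> v"
    and mini: "\<And>z. z \<in> strategies K e \<Longrightarrow> v \<le> inner (a \<odot> x) z"
    using opt strategy_nonzero unfolding optimal_pair_def v_def by auto
  have "v > 0"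
  proof -
    have "0 < inner (a \<odot> (e /\<^sub>R inner e e)) y"
      using interior_inner_pos[OF a y(1,2)] unit_nonzero by (simp add: right_scale unit_right)
    also have "\<dots> \<le> v"
      by (intro maxi normalized_strategy unit_in_cone unit_nonzero)
    finally show ?thesis .
  qed
  have "a \<odot> x \<in> interior K"
    unfolding interior_iff_inner_pos
  proof (intro ballI impI)
    fix z assume z: "z \<in> K" "z \<noteq> 0"
    have "0 < v" by fact
    also have "v \<le> inner (a \<odot> x) (z /\<^sub>R inner z e)"
      by (rule mini[OF normalized_strategy[OF z]])
    finally show "0 < inner (a \<odot> x) z"
      using inner_unit_pos[OF z] by (simp add: zero_less_mult_iff)
  qed
  then have xi: "x \<in> interior K"
    by (rule right_factor_in_interior[OF x(1)])
  define w where "w = v *\<^sub>R e - a \<odot> y"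
  have "w \<in> K"
    unfolding cone_self_dual[of w]
  proof
    fix z assume z: "z \<in> K"
    show "0 \<le> inner w z"
    proof (cases "z = 0")
      case False
      have "inner (a \<odot> (z /\<^sub>R inner z e)) y \<le> v"
        by (rule maxi[OF normalized_strategy[OF z False]])
      then have "inner (a \<odot> z) y \<le> v * inner z e"
        using inner_unit_pos[OF z False] by (simp add: right_scale field_simps)
      moreover have "inner (a \<odot> z) y = inner (a \<odot> y) z"
        using inner_assoc[of a z y] by (simp add: inner_commute)
      ultimately show ?thesis
        by (simp add: w_def inner_diff_left inner_commute[of e])
    qed simp
  qed
  moreover have "inner x w = 0"
    using inner_assoc[of a x y] x
    by (simp add: w_def inner_diff_right v_def)
  ultimately have "w = 0"
    using interior_inner_pos[OF xi, of w] by auto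
  then have "a \<odot> y = v *\<^sub>R e" by (simp add: w_def)
  then have "a \<odot> y \<in> interior K"
    using interior_scale[OF unit_in_interior \<open>v > 0\<close>] by simp
  then have "y \<in> interior K"
    by (rule right_factor_in_interior[OF y(1)])
  with xi show ?thesis by blast
qed

text \<open>
  The spectral decomposition of an element that is not a multiple of \<open>e\<close> has at least two members.
\<close>

lemma nontrivial_idempotents:
  assumes "DIM('a) \<ge> 2"
  shows "\<exists>c d. c \<odot> c = c \<and> d \<odot> d = d \<and> c \<noteq> 0 \<and> d \<noteq> 0 \<and> c \<odot> d = 0"
proof -
  have "dim {e} < DIM('a)"
    using assms unit_nonzero by simp
  then have "span {e} \<noteq> UNIV"
    using dim_eq_full by (metis order_less_irrefl)
  then obtain x where x: "x \<notin> span {e}" by blast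
  obtain F \<xi> where F: "spectral_decomposition x F \<xi>"
    using spectral_theorem by blast
  have "F \<noteq> {}"
    using F unit_nonzero by (auto simp: spectral_decomposition_def)
  then obtain c where c: "c \<in> F" by blast
  have "F \<noteq> {c}"
  proof
    assume "F = {c}"
    then have "x = \<xi> c *\<^sub>R e" using F by (simp add: spectral_decomposition_def)
    then show False using x by (simp add: span_base span_scale)
  qed
  then obtain d where "d \<in> F" "d \<noteq> c" using c by blast
  then show ?thesis
    using c F unfolding spectral_decomposition_def orthogonal_idempotents_def by metis
qed

text \<open>
  With \<open>x\<close> and \<open>y\<close> the normalizations of \<open>c\<close> and \<open>d\<close>, any strategy \<open>z\<close> earns \<open>\<beta> * inner z y \<le> 0\<close>
  against \<open>y\<close>, and \<open>x\<close> earns \<open>\<alpha> * inner x z \<ge> 0\<close> against any \<open>z\<close>. The strategy \<open>x\<close> lies on the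
  boundary because it is orthogonal to \<open>y \<in> K\<close>.
\<close>

lemma indefinite_game_zero_value:
  assumes c: "c \<odot> c = c" "c \<noteq> 0" "a \<odot> c = \<alpha> *\<^sub>R c" "0 \<le> \<alpha>"
    and d: "d \<odot> d = d" "d \<noteq> 0" "a \<odot> d = \<beta> *\<^sub>R d" "\<beta> \<le> 0"
    and cd: "c \<odot> d = 0"
  shows "\<exists>x y. optimal_pair K e (\<lambda>x. a \<odot> x) x y \<and> inner (a \<odot> x) y = 0 \<and> x \<notin> interior K"
proof -
  define x where "x = c /\<^sub>R inner c e"
  define y where "y = d /\<^sub>R inner d e"
  have cK: "c \<in> K" and dK: "d \<in> K"
    using c d idempotent_in_cone by auto
  have xy: "x \<in> strategies K e" "y \<in> strategies K e"
    using normalized_strategy cK dK c d by (auto simp: x_def y_def)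
  have ax: "a \<odot> x = \<alpha> *\<^sub>R x" and ay: "a \<odot> y = \<beta> *\<^sub>R y"
    by (simp_all add: x_def y_def right_scale c d)
  have "inner c d = inner (c \<odot> d) e"
    using inner_assoc[of c d e] by (simp add: unit_right inner_commute)
  then have ortho: "inner c d = 0" by (simp add: cd)
  then have xy0: "inner x y = 0" by (simp add: x_def y_def)
  have "inner (a \<odot> z) y \<le> 0" if "z \<in> strategies K e" for z
  proof -
    have "inner (a \<odot> z) y = \<beta> * inner z y"
      using inner_assoc[of a z y] by (simp add: ay)
    moreover have "0 \<le> inner z y"
      using that xy strategy_nonzero cone_self_dual by blast
    ultimately show ?thesis using d(4) by (simp add: mult_nonpos_nonneg)
  qed
  moreover have "0 \<le> inner (a \<odot> x) z" if "z \<in> strategies K e" for z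
  proof -
    have "0 \<le> inner x z"
      using that xy strategy_nonzero cone_self_dual by blast
    then show ?thesis using c(4) by (simp add: ax)
  qed
  moreover have "inner (a \<odot> x) y = 0" by (simp add: ax xy0)
  ultimately have "optimal_pair K e (\<lambda>x. a \<odot> x) x y"
    using xy by (simp add: optimal_pair_def)
  moreover have "x \<notin> interior K"
    using interior_inner_pos[of x y] xy strategy_nonzero xy0 by force
  ultimately show ?thesis using \<open>inner (a \<odot> x) y = 0\<close> by blast
qed

text \<open>
  A nonzero \<open>a\<close> has a nonzero coefficient, which supplies one of the two idempotents of opposite weak
  sign, and the sign assumptions supply a different one. For \<open>a = 0\<close> its decomposition may consist
  of \<open>e\<close> alone; any two orthogonal idempotents do, and they exist from dimension 2 on.
\<close>

lemma indefinite_game: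
  assumes a: "a \<notin> interior K" "- a \<notin> interior K" and nontriv: "DIM('a) \<ge> 2 \<or> a \<noteq> 0"
  shows "\<exists>x y. optimal_pair K e (\<lambda>x. a \<odot> x) x y \<and> inner (a \<odot> x) y = 0 \<and> x \<notin> interior K"
proof (cases "a = 0")
  case True
  then obtain c d where "c \<odot> c = c" "d \<odot> d = d" "c \<noteq> 0" "d \<noteq> 0" "c \<odot> d = 0"
    using nontriv nontrivial_idempotents by blast
  then show ?thesis
    using indefinite_game_zero_value[of c a 0 d 0] True by (simp add: left_zero)
next
  case False
  obtain F \<alpha> where F: "spectral_decomposition a F \<alpha>"
    using spectral_theorem by blast
  then have "spectral_decomposition (- a) F (\<lambda>c. - \<alpha> c)"
    by (simp add: spectral_decomposition_def sum_negf)
  then have signs: "\<exists>c\<in>F. \<alpha> c \<le> 0" "\<exists>c\<in>F. 0 \<le> \<alpha> c"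
    using a interior_iff_eigenvalues F by force+
  obtain k where k: "k \<in> F" "\<alpha> k \<noteq> 0"
  proof -
    have "\<exists>k\<in>F. \<alpha> k \<noteq> 0"
    proof (rule ccontr)
      assume "\<not> ?thesis"
      then have "a = 0" using F by (simp add: spectral_decomposition_def)
      with False show False by blast
    qed
    then show ?thesis using that by blast
  qed
  have "\<exists>c\<in>F. \<exists>d\<in>F. c \<noteq> d \<and> 0 \<le> \<alpha> c \<and> \<alpha> d \<le> 0"
    using signs k by (metis linorder_linear order_antisym)
  then obtain c d where cd: "c \<in> F" "d \<in> F" "c \<noteq> d" "0 \<le> \<alpha> c" "\<alpha> d \<le> 0" by blast
  have "c \<odot> d = 0"
    using cd F by (simp add: spectral_decomposition_def orthogonal_idempotents_def)
  then show ?thesis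
    using indefinite_game_zero_value spectral_member[OF F] spectral_mult[OF F] cd by metis
qed

end

theorem theorem4p8:
  fixes jprod :: "'a::euclidean_space \<Rightarrow> 'a \<Rightarrow> 'a" and e a :: 'a
  assumes "euclidean_jordan_algebra jprod e"
    and "\<And>x y. inner x y = jordan_trace jprod e (jprod x y)"
    and "DIM('a) \<ge> 2 \<or> a \<noteq> 0"
  shows "(completely_mixed (symmetric_cone jprod) e (\<lambda>x. jprod a x) \<longleftrightarrow>
            a \<in> interior (symmetric_cone jprod) \<or> - a \<in> interior (symmetric_cone jprod)) \<and>
         (a \<in> interior (symmetric_cone jprod) \<or> - a \<in> interior (symmetric_cone jprod) \<longleftrightarrow>
            game_value (symmetric_cone jprod) e (\<lambda>x. jprod a x) \<noteq> 0)"
proof -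
  interpret euclidean_jordan_algebra jprod e by fact
  let ?L = "\<lambda>x. jprod a x"
  consider (pos) "a \<in> interior K" | (neg) "- a \<in> interior K"
    | (indef) "a \<notin> interior K" "- a \<notin> interior K" by blast
  then show ?thesis
  proof cases
    case pos
    then obtain x y where "optimal_pair K e ?L x y" "0 < inner (jprod a x) y"
      using positive_game_has_positive_value by blast
    then have "game_value K e ?L \<noteq> 0"
      using game_value_eq by (metis order_less_irrefl)
    moreover have "completely_mixed K e ?L"
      using positive_game_completely_mixed[OF pos] by (simp add: completely_mixed_def)
    ultimately show ?thesis using pos by blast
  next
    case neg
    then obtain x y where xy: "optimal_pair K e (\<lambda>x. jprod (- a) x) x y"
      "0 < inner (jprod (- a) x) y"
      using positive_game_has_positive_value by blast
    have "optimal_pair K e ?L y x"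
      using xy(1) optimal_pair_neg by blast
    moreover have "inner (jprod a y) x \<noteq> 0"
      using xy(2) inner_assoc[of a y x] by (simp add: left_minus inner_commute)
    ultimately have "game_value K e ?L \<noteq> 0"
      using game_value_eq by metis
    moreover have "completely_mixed K e ?L"
      using positive_game_completely_mixed[OF neg] optimal_pair_neg
      unfolding completely_mixed_def by blast
    ultimately show ?thesis using neg by blast
  next
    case indef
    obtain x y where "optimal_pair K e ?L x y" "inner (jprod a x) y = 0" "x \<notin> interior K"
      using indefinite_game[OF indef assms(3)] by blast
    then have "game_value K e ?L = 0" by (simp add: game_value_eq)
    moreover have "\<not> completely_mixed K e ?L"
      using \<open>optimal_pair K e ?L x y\<close> \<open>x \<notin> interior K\<close> by (auto simp: completely_mixed_def)
    ultimately show ?thesis using indef by blast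
  qed
qed

end
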